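(* Let $q$ be a prime power, let $F$ be a field containing $\mathbb{F}_q$, and let $f(z)=\sum_{i\ge 0} f_i z^{q^i}\in F[[z]]$. Write $a(z)=zf'(z)/(1-f(z))=\sum_{i\ge 0} a_iz^i\in F[[z]]$. Then for every integer $s$ with $1\le s<q$, every integer $k\ge 1$, and all integers $k_1,\dots,k_s$ with $0\le k_i<k$, $$\prod_{i=1}^s a_{q^k-q^{k_i}} = f_0^{(s-1)q^k}\, a_{q^k-\sum_{i=1}^s q^{k_i}}.$$
   Context: Here $f'$ is the formal derivative, so $f'(z)=f_0$ and $a(z)=f_0z/(1-f(z))$. *)

theory Defs
  imports
    "HOL-Computational_Algebra.Formal_Power_Series"
    "HOL-Number_Theory.Prime_Powers"
begin

definition is_subfield :: "'a::field set \<Rightarrow> bool" where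
  "is_subfield K \<longleftrightarrow>
     0 \<in> K \<and> 1 \<in> K \<and>
     (\<forall>x\<in>K. \<forall>y\<in>K. x + y \<in> K \<and> x * y \<in> K) \<and>
     (\<forall>x\<in>K. - x \<in> K \<and> inverse x \<in> K)"

text \<open>
  The series \<open>c 0 * z ^ (q ^ 0) + c 1 * z ^ (q ^ 1) + c 2 * z ^ (q ^ 2) + \<dots>\<close>.  For \<open>q > 1\<close>, the
  inner sum has at most one summand.
\<close>

definition q_power_series :: "nat \<Rightarrow> (nat \<Rightarrow> 'a::comm_ring_1) \<Rightarrow> 'a fps" where
  "q_power_series q c = Abs_fps (\<lambda>n. \<Sum>i | q ^ i = n. c i)"

lemma fps_nth_q_power_series_power:
  assumes "q > 1"
  shows "fps_nth (q_power_series q c) (q ^ i) = c i"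
proof -
  have "{j. q ^ j = q ^ i} = {i}"
    using assms by auto
  then show ?thesis
    by (simp add: q_power_series_def)
qed

lemma fps_nth_q_power_series_other:
  assumes "\<And>i. n \<noteq> q ^ i"
  shows "fps_nth (q_power_series q c) n = 0"
proof -
  have "{j. q ^ j = n} = {}"
    using assms by blast
  then show ?thesis
    by (simp add: q_power_series_def)
qed

text \<open>The defining coefficients are those of the convergent sum in the topology of formal power series.\<close>

lemma q_power_series_sums:
  assumes q: "q > 1"
  shows "(\<lambda>i. fps_const (c i) * fps_X ^ (q ^ i)) sums q_power_series q c"
  unfolding sums_def
proof (rule tendsto_fpsI)
  fix n
  have "fps_nth (\<Sum>i<m. fps_const (c i) * fps_X ^ (q ^ i)) n = fps_nth (q_power_series q c) n"
    if m: "m > n" for m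
  proof -
    have lt: "i < m" if "q ^ i = n" for i
      using less_exp[of i] power_mono[of 2 q i] q m that by linarith
    have "fps_nth (\<Sum>i<m. fps_const (c i) * fps_X ^ (q ^ i)) n
        = (\<Sum>i<m. if q ^ i = n then c i else 0)"
      by (auto simp: fps_sum_nth intro!: sum.cong)
    also have "\<dots> = (\<Sum>i\<in>{i\<in>{..<m}. q ^ i = n}. c i)"
      by (rule sum.inter_filter[symmetric]) simp
    also have "{i\<in>{..<m}. q ^ i = n} = {i. q ^ i = n}"
      using lt by auto
    finally show ?thesis
      by (simp add: q_power_series_def)
  qed
  then show "\<forall>\<^sub>F m in sequentially.
      fps_nth (\<Sum>i<m. fps_const (c i) * fps_X ^ (q ^ i)) n = fps_nth (q_power_series q c) n"
    by (rule eventually_mono[OF eventually_gt_at_top])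
qed

end

theory Submission
  imports Defs
begin

text \<open>
  Let \<open>g = 1 - f\<close> and let \<open>\<Phi> k m\<close> be the coefficient of \<open>z ^ (q ^ k - 1)\<close> in \<open>z ^ m / g\<close>.
  Since \<open>f' = c 0\<close>, the coefficient of \<open>a\<close> at \<open>q ^ k - m\<close> is \<open>c 0 * \<Phi> k m\<close>.
  By Frobenius, \<open>g ^ (q ^ j)\<close> is supported on \<open>0\<close> and powers of \<open>q\<close>, so \<open>g ^ (q ^ j - 1)\<close> is
  supported on exponents with base-\<open>q\<close> digit sum at most \<open>j * (q - 1)\<close>, whereas \<open>q ^ k - 1\<close> has
  digit sum \<open>k * (q - 1)\<close>.  Hence \<open>z ^ M * g ^ (q ^ j) / g\<close> has no term \<open>z ^ (q ^ k - 1)\<close> when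
  \<open>j < k\<close> and \<open>M\<close> has digit sum at most \<open>q - 2\<close>; expanding \<open>g ^ (q ^ j)\<close> gives linear relations
  expressing \<open>\<Phi> k M\<close> through the values \<open>\<Phi> k (M + q ^ i)\<close>.  They force
  \<open>\<Phi> k (M + q ^ j) * \<Phi> k 0 = \<Phi> k M * \<Phi> k (q ^ j)\<close>, and the product formula follows by induction on the
  number of factors, together with \<open>\<Phi> k 0 = c 0 ^ (q ^ k - 1)\<close>.
\<close>

section \<open>Frobenius powers of formal power series\<close>

text \<open>Frobenius is additive on finite sums, so \<open>F\<close> is split into its terms up to
  degree \<open>n\<close> and a tail; the \<open>Q\<close>-th power of the tail starts beyond degree
  \<open>n\<close>.\<close>

lemma fps_nth_power_CHAR_power:
  fixes F :: "'a::comm_ring_1 fps"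
  assumes char: "prime CHAR('a)" and Q: "Q = CHAR('a) ^ e"
  shows "fps_nth (F ^ Q) n = (if Q dvd n then fps_nth F (n div Q) ^ Q else 0)"
proof -
  have char': "prime CHAR('a fps)" and Q': "Q = CHAR('a fps) ^ e"
    using char Q by auto
  have "Q > 0"
    using char Q prime_gt_0_nat by simp
  define S where "S = fps_shift (Suc n) F"
  have "F = (\<Sum>i\<le>n. fps_const (fps_nth F i) * fps_X ^ i) + fps_X ^ Suc n * S"
    unfolding S_def
    by (rule fps_ext)
      (auto simp: fps_sum_nth fps_X_power_mult_nth if_distrib[of "\<lambda>x. _ * x"]
        simp del: power_Suc cong: if_cong)
  then have "F ^ Q = (\<Sum>i\<le>n. fps_const (fps_nth F i) * fps_X ^ i) ^ Q + (fps_X ^ Suc n * S) ^ Q"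
    using freshmans_dream'[OF char' Q'] by metis
  also have "\<dots> = (\<Sum>i\<le>n. (fps_const (fps_nth F i) * fps_X ^ i) ^ Q) + (fps_X ^ Suc n * S) ^ Q"
    by (subst freshmans_dream_sum'[OF char' Q']) simp
  also have "\<dots> = (\<Sum>i\<le>n. fps_const (fps_nth F i ^ Q) * fps_X ^ (i * Q)) + fps_X ^ (Suc n * Q) * S ^ Q"
    by (simp add: power_mult_distrib flip: power_mult fps_const_power del: power_Suc)
  finally have "fps_nth (F ^ Q) n
      = (\<Sum>i\<le>n. fps_nth F i ^ Q * (if n = i * Q then 1 else 0)) + fps_nth (fps_X ^ (Suc n * Q) * S ^ Q) n"
    by (simp add: fps_sum_nth)
  moreover have "n < Suc n * Q"
    using \<open>Q > 0\<close> by (cases Q) auto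
  ultimately have *: "fps_nth (F ^ Q) n = (\<Sum>i\<le>n. fps_nth F i ^ Q * (if n = i * Q then 1 else 0))"
    by (simp only: fps_X_power_mult_nth if_True add_0_right)
  show ?thesis
  proof (cases "Q dvd n")
    case True
    then obtain m where m: "n = m * Q"
      by (metis dvdE mult.commute)
    have "fps_nth (F ^ Q) n = (\<Sum>i\<le>n. if i = m then fps_nth F i ^ Q else 0)"
      unfolding * using m \<open>Q > 0\<close> by (intro sum.cong) auto
    moreover have "m \<le> n"
      using m \<open>Q > 0\<close> by simp
    ultimately show ?thesis
      using m \<open>Q > 0\<close> by simp
  next
    case False
    then have "fps_nth (F ^ Q) n = 0"
      unfolding * by (intro sum.neutral) auto
    with False show ?thesis
      by simp
  qed
qed

section \<open>Order of a finite subfield and the characteristic\<close>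

text \<open>Translation by 1 permutes \<open>K\<close>, yet it adds \<open>card K\<close> to the sum
  of the elements.\<close>

lemma of_nat_card_subfield_eq_0:
  fixes K :: "'a::field set"
  assumes K: "is_subfield K"
  shows "of_nat (card K) = (0 :: 'a)"
proof -
  have "x + (- 1) \<in> K" "x + 1 \<in> K" if "x \<in> K" for x
    using K that unfolding is_subfield_def by blast+
  then have "bij_betw (\<lambda>x. x + 1) K K"
    by (intro bij_betwI[where g = "\<lambda>x. x + (- 1)"]) auto
  then have "(\<Sum>x\<in>K. x + 1) = (\<Sum>x\<in>K. x)"
    by (rule sum.reindex_bij_betw)
  then show ?thesis
    by (simp add: sum.distrib)
qed

lemma primepow_card_subfield:
  fixes K :: "'a::field set"
  assumes "primepow (card K)" and K: "is_subfield K"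
  obtains e where "prime CHAR('a)" and "card K = CHAR('a) ^ e"
proof -
  obtain p m where p: "prime p" "card K = p ^ m"
    using assms(1) unfolding primepow_def by auto
  have dvd: "CHAR('a) dvd p ^ m"
    using of_nat_card_subfield_eq_0[OF K] p by (simp only: of_nat_eq_0_iff_char_dvd)
  have "p ^ m > 0"
    using p prime_gt_0_nat by simp
  then have "CHAR('a) > 0"
    using dvd by (auto intro!: Nat.gr0I)
  then have char: "prime CHAR('a)"
    by (rule prime_CHAR_semidom)
  then have "CHAR('a) = p"
    using dvd p by (meson prime_dvd_power primes_dvd_imp_eq)
  with char p that show ?thesis
    by blast
qed

section \<open>Base-q digit sums\<close>

fun digit_sum :: "nat \<Rightarrow> nat \<Rightarrow> nat" where
  "digit_sum q n = (if n = 0 \<or> q \<le> 1 then 0 else n mod q + digit_sum q (n div q))"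

declare digit_sum.simps [simp del]

lemma digit_sum_0 [simp]: "digit_sum q 0 = 0"
  by (simp add: digit_sum.simps)

lemma digit_sum_rec: "q > 1 \<Longrightarrow> digit_sum q n = n mod q + digit_sum q (n div q)"
  by (subst digit_sum.simps) auto

lemma digit_sum_power: "q > 1 \<Longrightarrow> digit_sum q (q ^ i) = 1"
  by (induction i) (simp_all add: digit_sum_rec[of q "Suc 0"] digit_sum_rec[of q "q * _"])

text \<open>A carry takes q from one digit and adds only 1 to the next. The carry is treated as a
  further summand of the quotients, so the induction hypothesis is used twice.\<close>

lemma digit_sum_add_le:
  assumes q: "q > 1"
  shows "digit_sum q (n + m) \<le> digit_sum q n + digit_sum q m"
proof (induction "n + m" arbitrary: n m rule: less_induct)
  case less
  show ?case
  proof (cases "n = 0 \<or> m = 0")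
    case False
    define carry where "carry = (n mod q + m mod q) div q"
    have "n mod q + m mod q < 2 * q"
      using q by (simp add: add_strict_mono mult_2)
    then have carry: "carry \<le> 1"
      unfolding carry_def by (simp add: div_less_iff_less_mult less_Suc_eq_le[symmetric] q)
    have *: "(n + m) div q = n div q + m div q + carry"
      unfolding carry_def by (rule div_add1_eq)
    have decr: "n div q < n" "m div q < m"
      using False q by auto
    have "n div q + m div q + carry < n + m"
      using decr carry by linarith
    then have "digit_sum q (n div q + m div q + carry)
        \<le> digit_sum q (n div q + m div q) + digit_sum q carry"
      using less[of "n div q + m div q" carry] by simp
    also have "digit_sum q (n div q + m div q) \<le> digit_sum q (n div q) + digit_sum q (m div q)"
      using less[of "n div q" "m div q"] decr by simp
    also have "digit_sum q carry = carry"
      using carry q digit_sum_power[OF q, of 0] by (cases carry) auto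
    finally have 1: "digit_sum q ((n + m) div q)
        \<le> digit_sum q (n div q) + digit_sum q (m div q) + carry"
      unfolding * by simp
    have "(n + m) mod q = (n mod q + m mod q) mod q"
      by (simp add: mod_add_eq)
    moreover have "carry * q + (n mod q + m mod q) mod q = n mod q + m mod q"
      unfolding carry_def by (rule div_mult_mod_eq)
    moreover have "carry \<le> carry * q"
      using q by simp
    ultimately have 2: "(n + m) mod q + carry \<le> n mod q + m mod q"
      by linarith
    show ?thesis
      using 1 2 digit_sum_rec[OF q, of "n + m"] digit_sum_rec[OF q, of n] digit_sum_rec[OF q, of m]
      by linarith
  qed auto
qed

lemma digit_sum_sum_powers_le:
  assumes q: "q > 1" and "finite I"
  shows "digit_sum q (\<Sum>i\<in>I. q ^ \<kappa> i) \<le> card I"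
  using assms(2)
proof (induction I rule: finite_induct)
  case (insert i I)
  then show ?case
    using digit_sum_add_le[OF q, of "q ^ \<kappa> i" "\<Sum>i\<in>I. q ^ \<kappa> i"] digit_sum_power[OF q, of "\<kappa> i"]
    by simp
qed simp

text \<open>All \<open>k\<close> digits equal \<open>q - 1\<close>.\<close>

lemma digit_sum_power_minus_1:
  assumes q: "q > 1"
  shows "digit_sum q (q ^ k - 1) = k * (q - 1)"
proof (induction k)
  case (Suc k)
  have "q ^ k > 0"
    using q by simp
  then have "q ^ Suc k - 1 = (q - 1) + q * (q ^ k - 1)"
    using q by (cases "q ^ k") (auto simp: algebra_simps)
  moreover have "((q - 1) + q * x) mod q = q - 1" "((q - 1) + q * x) div q = x" for x
    using q by (auto simp del: add_diff_assoc2)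
  ultimately show ?case
    using Suc digit_sum_rec[OF q, of "q ^ Suc k - 1"] by (simp only: mult_Suc)
qed simp

section \<open>Series supported on exponents of bounded digit sum\<close>

definition digit_bounded :: "nat \<Rightarrow> nat \<Rightarrow> 'a::zero fps \<Rightarrow> bool" where
  "digit_bounded q N F \<longleftrightarrow> (\<forall>n. fps_nth F n \<noteq> 0 \<longrightarrow> digit_sum q n \<le> N)"

lemma digit_bounded_1: "digit_bounded q 0 1"
  by (auto simp: digit_bounded_def)

lemma digit_bounded_mult:
  fixes F G :: "'a::comm_ring_1 fps"
  assumes q: "q > 1" and F: "digit_bounded q N F" and G: "digit_bounded q M G"
  shows "digit_bounded q (N + M) (F * G)"
  unfolding digit_bounded_def
proof (intro allI impI)
  fix n
  assume "fps_nth (F * G) n \<noteq> 0"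
  then obtain i where i: "i \<le> n" "fps_nth F i * fps_nth G (n - i) \<noteq> 0"
    unfolding fps_mult_nth by (metis (no_types, lifting) atLeastAtMost_iff sum.neutral)
  then have "fps_nth F i \<noteq> 0" "fps_nth G (n - i) \<noteq> 0"
    by auto
  then have "digit_sum q i \<le> N" "digit_sum q (n - i) \<le> M"
    using F G unfolding digit_bounded_def by blast+
  then show "digit_sum q n \<le> N + M"
    using digit_sum_add_le[OF q, of i "n - i"] i by simp
qed

lemma digit_bounded_power:
  fixes F :: "'a::comm_ring_1 fps"
  assumes q: "q > 1" and F: "digit_bounded q N F"
  shows "digit_bounded q (r * N) (F ^ r)"
  by (induction r) (use digit_bounded_mult[OF q F] digit_bounded_1 in auto)

section \<open>Coefficients of the reciprocal of g\<close>

locale q_power_reciprocal =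
  fixes q e :: nat and c :: "nat \<Rightarrow> 'a::field"
  assumes q: "q > 1" and char: "prime CHAR('a)" and q_eq: "q = CHAR('a) ^ e"
begin

definition g :: "'a fps" where
  "g = 1 - q_power_series q c"

text \<open>The factor z^m, in place of an index \<open>q ^ k - 1 - m\<close>, gives the value 0 for
  \<open>m \<ge> q ^ k\<close>, where subtraction of naturals would truncate; such \<open>m\<close>
  can occur in the linear relations.\<close>

definition \<Phi> :: "nat \<Rightarrow> nat \<Rightarrow> 'a" where
  "\<Phi> k m = fps_nth (fps_X ^ m * inverse g) (q ^ k - 1)"

lemma nth_g_0 [simp]: "fps_nth g 0 = 1"
  using q by (simp add: g_def fps_nth_q_power_series_other)

lemma g_mult_inverse: "g * inverse g = 1"
  by (rule inverse_mult_eq_1') simp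

lemma \<Phi>_eq:
  assumes "m < q ^ k"
  shows "\<Phi> k m = fps_nth (inverse g) (q ^ k - 1 - m)"
  using assms by (simp add: \<Phi>_def fps_X_power_mult_nth)

lemma power_q_eq: "q ^ j = CHAR('a) ^ (e * j)"
  by (simp add: q_eq power_mult)

lemma nth_g_power:
  "fps_nth (g ^ (q ^ j)) n = (if q ^ j dvd n then fps_nth g (n div q ^ j) ^ (q ^ j) else 0)"
  using fps_nth_power_CHAR_power[OF char power_q_eq] .

lemma nth_g_nonzero:
  assumes "fps_nth g n \<noteq> 0"
  shows "n = 0 \<or> (\<exists>i. n = q ^ i)"
  using assms fps_nth_q_power_series_other[of n q c] by (auto simp: g_def split: if_splits)

lemma digit_bounded_g_power: "digit_bounded q 1 (g ^ (q ^ j))"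
  unfolding digit_bounded_def
proof (intro allI impI)
  fix n
  assume n: "fps_nth (g ^ (q ^ j)) n \<noteq> 0"
  then obtain m where m: "n = q ^ j * m"
    unfolding nth_g_power by (auto split: if_splits elim: dvdE)
  have "fps_nth g m \<noteq> 0"
    using n q unfolding nth_g_power m by (auto simp: power_0_left)
  then consider "m = 0" | i where "m = q ^ i"
    using nth_g_nonzero by blast
  then show "digit_sum q n \<le> 1"
  proof cases
    case 2
    then show ?thesis
      using digit_sum_power[OF q, of "j + i"] by (simp add: m power_add)
  qed (simp add: m)
qed

lemma digit_bounded_g_power_minus_1: "digit_bounded q (j * (q - 1)) (g ^ (q ^ j - 1))"
proof (induction j)
  case (Suc j)
  have "q ^ j > 0"
    using q by simp
  \<comment> \<open>Each of the \<open>q - 1\<close> factors \<open>g ^ (q ^ j)\<close> split off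
    here raises the digit sum by at most 1.\<close>
  then have "q ^ Suc j - 1 = (q ^ j - 1) + q ^ j * (q - 1)"
    using q by (cases q) (auto simp: mult.commute)
  then have "g ^ (q ^ Suc j - 1) = g ^ (q ^ j - 1) * (g ^ (q ^ j)) ^ (q - 1)"
    by (simp only: power_add power_mult)
  moreover have "digit_bounded q (j * (q - 1) + (q - 1) * 1) \<dots>"
    by (intro digit_bounded_mult digit_bounded_power digit_bounded_g_power q Suc)
  ultimately show ?case
    by (simp only: mult_Suc mult_1_right add.commute)
qed (simp add: digit_bounded_1)

text \<open>Exponents in the support have digit sum at most (q - 2) + (k - 1)(q - 1), which is less
  than k(q - 1), the digit sum of \<open>q ^ k - 1\<close>.\<close>

lemma nth_X_power_mult_g_power_eq_0:
  assumes M: "digit_sum q M + 2 \<le> q" and j: "j < k"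
  shows "fps_nth (fps_X ^ M * g ^ (q ^ j - 1)) (q ^ k - 1) = 0"
proof (rule ccontr)
  let ?N = "q ^ k - 1"
  assume "fps_nth (fps_X ^ M * g ^ (q ^ j - 1)) ?N \<noteq> 0"
  then have "M \<le> ?N" and "fps_nth (g ^ (q ^ j - 1)) (?N - M) \<noteq> 0"
    by (auto simp: fps_X_power_mult_nth split: if_splits)
  then have "digit_sum q (?N - M) \<le> j * (q - 1)"
    using digit_bounded_g_power_minus_1 unfolding digit_bounded_def by blast
  moreover have "digit_sum q ?N \<le> digit_sum q M + digit_sum q (?N - M)"
    using digit_sum_add_le[OF q, of M "?N - M"] \<open>M \<le> ?N\<close>
    by (simp only: le_add_diff_inverse)
  moreover have "Suc j * (q - 1) \<le> k * (q - 1)"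
    using j by (intro mult_right_mono) auto
  moreover have "Suc j * (q - 1) = j * (q - 1) + (q - 1)"
    by simp
  ultimately show False
    using M q digit_sum_power_minus_1[OF q, of k] by linarith
qed

text \<open>The omitted terms, those with \<open>i \<ge> k - j\<close>, have degree at least
  \<open>q ^ k\<close>.\<close>

lemma nth_g_power_truncated:
  assumes n: "n < q ^ k"
  shows "fps_nth (g ^ (q ^ j)) n
    = fps_nth (1 - (\<Sum>i<k - j. fps_const (c i ^ (q ^ j)) * fps_X ^ (q ^ (i + j)))) n"
proof -
  have sum: "fps_nth (\<Sum>i<k - j. fps_const (c i ^ (q ^ j)) * fps_X ^ (q ^ (i + j))) n
      = (\<Sum>i<k - j. if n = q ^ (i + j) then c i ^ (q ^ j) else 0)"
    by (auto simp: fps_sum_nth intro!: sum.cong)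
  consider "n = 0" | i where "n = q ^ (i + j)" | "n \<noteq> 0" "\<And>i. n \<noteq> q ^ (i + j)"
    by blast
  then show ?thesis
  proof cases
    case 1
    have "n \<noteq> q ^ (i + j)" for i
      using 1 q by simp
    then show ?thesis
      using sum q by (simp add: 1 fps_power_zeroth)
  next
    case 2
    have "i + j < k"
      using n 2 q by (simp add: power_strict_increasing_iff)
    have "(\<Sum>i'<k - j. if n = q ^ (i' + j) then c i' ^ (q ^ j) else 0)
        = (\<Sum>i'<k - j. if i' = i then c i' ^ (q ^ j) else 0)"
      using 2 q by (intro sum.cong) auto
    also have "\<dots> = c i ^ (q ^ j)"
      using \<open>i + j < k\<close> by simp
    finally have R: "fps_nth (1 - (\<Sum>i<k - j. fps_const (c i ^ (q ^ j)) * fps_X ^ (q ^ (i + j)))) n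
        = - (c i ^ (q ^ j))"
      using 2 q sum by simp
    have "n div q ^ j = q ^ i" "q ^ j dvd n"
      using 2 q by (auto simp: power_add)
    moreover have "fps_nth g (q ^ i) = 0 - c i"
      using q by (simp add: g_def fps_nth_q_power_series_power)
    ultimately have "fps_nth (g ^ (q ^ j)) n = (0 - c i) ^ (q ^ j)"
      by (simp add: nth_g_power)
    \<comment> \<open>Additivity of Frobenius settles the sign in every characteristic, without a
      case split on the parity of \<open>q ^ j\<close>.\<close>
    moreover have "(0 - c i) ^ (q ^ j) + c i ^ (q ^ j) = (0 - c i + c i) ^ (q ^ j)"
      by (rule freshmans_dream'[OF char power_q_eq, symmetric])
    ultimately show ?thesis
      unfolding R using q by (simp add: power_0_left eq_neg_iff_add_eq_0)
  next
    case 3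
    have "fps_nth (g ^ (q ^ j)) n = 0"
    proof (rule ccontr)
      assume nz: "fps_nth (g ^ (q ^ j)) n \<noteq> 0"
      then obtain m where m: "n = q ^ j * m"
        unfolding nth_g_power by (auto split: if_splits elim: dvdE)
      have "fps_nth g m \<noteq> 0"
        using nz q unfolding nth_g_power m by (auto simp: power_0_left)
      then show False
        using nth_g_nonzero[of m] 3 m by (auto simp: power_add mult.commute)
    qed
    then show ?thesis
      using 3 sum by simp
  qed
qed

text \<open>The difference of the two sides is the coefficient of \<open>z ^ (q ^ k - 1)\<close> in \<open>z ^ M * g ^ (q ^ j) / g\<close>.\<close>

lemma \<Phi>_linear_relation:
  assumes M: "digit_sum q M + 2 \<le> q" and j: "j < k"
  shows "\<Phi> k M = (\<Sum>i<k - j. c i ^ (q ^ j) * \<Phi> k (M + q ^ (i + j)))"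
proof -
  let ?N = "q ^ k - 1"
  let ?T = "1 - (\<Sum>i<k - j. fps_const (c i ^ (q ^ j)) * fps_X ^ (q ^ (i + j)))"
  let ?H = "fps_X ^ M * inverse g"
  have "q ^ j > 0" "q ^ k > 0"
    using q by auto
  \<comment> \<open>One factor \<open>g\<close> is set aside to cancel
    \<open>inverse g\<close>.\<close>
  have "g ^ (q ^ j) = g * g ^ (q ^ j - 1)"
    using \<open>q ^ j > 0\<close> by (metis Suc_pred' power_Suc)
  then have "g ^ (q ^ j) * ?H = fps_X ^ M * g ^ (q ^ j - 1) * (g * inverse g)"
    by (simp only: mult_ac)
  then have "g ^ (q ^ j) * ?H = fps_X ^ M * g ^ (q ^ j - 1)"
    by (simp only: g_mult_inverse mult_1_right)
  then have "fps_nth (g ^ (q ^ j) * ?H) ?N = 0"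
    by (simp only: nth_X_power_mult_g_power_eq_0[OF M j])
  \<comment> \<open>The coefficient at \<open>?N\<close> involves \<open>g ^ (q ^ j)\<close> only
    below degree \<open>q ^ k\<close>, so the truncation may replace it.\<close>
  moreover have "fps_nth (g ^ (q ^ j) * ?H) ?N = fps_nth (?T * ?H) ?N"
    unfolding fps_mult_nth[of _ ?H]
    by (intro sum.cong refl arg_cong2[where f = "(*)"] nth_g_power_truncated)
      (use \<open>q ^ k > 0\<close> in \<open>unfold atLeastAtMost_iff, linarith\<close>)
  moreover have "?T * ?H
      = ?H - (\<Sum>i<k - j. fps_const (c i ^ (q ^ j)) * (fps_X ^ (M + q ^ (i + j)) * inverse g))"
    unfolding left_diff_distrib mult_1_left sum_distrib_right
    by (intro arg_cong2[where f = "(-)"] sum.cong refl) (simp add: power_add[of _ M] mult_ac)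
  ultimately show ?thesis
    by (simp add: \<Phi>_def fps_sum_nth del: fps_const_power)
qed

text \<open>
  For fixed \<open>M\<close> the linear relations form a triangular system for the values \<open>\<Phi> k (M + q ^ j)\<close>
  with diagonal entries \<open>c 0 ^ (q ^ j)\<close> and right-hand side \<open>\<Phi> k M\<close>, so the solution is
  proportional to the one for \<open>M = 0\<close>.
\<close>

lemma \<Phi>_add_power:
  assumes c0: "c 0 \<noteq> 0" and M: "digit_sum q M + 2 \<le> q" and "j < k"
  shows "\<Phi> k (M + q ^ j) * \<Phi> k 0 = \<Phi> k M * \<Phi> k (q ^ j)"
  using \<open>j < k\<close>
\<comment> \<open>Back substitution: it starts at \<open>j = k - 1\<close>, where the relation has a
  single term, and descends in \<open>j\<close>.\<close>
proof (induction "k - j" arbitrary: j rule: less_induct)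
  case less
  let ?d = "\<lambda>i. c i ^ (q ^ j)"
  obtain l where l: "k - j = Suc l"
    using less.prems by (metis Suc_diff_Suc)
  have rel: "\<Phi> k m = ?d 0 * \<Phi> k (m + q ^ j) + (\<Sum>i<l. ?d (Suc i) * \<Phi> k (m + q ^ (Suc i + j)))"
    if "digit_sum q m + 2 \<le> q" for m
    using \<Phi>_linear_relation[OF that less.prems] by (simp add: l sum.lessThan_Suc_shift del: sum.lessThan_Suc power_Suc)
  have IH: "\<Phi> k (M + q ^ (Suc i + j)) * \<Phi> k 0 = \<Phi> k M * \<Phi> k (q ^ (Suc i + j))" if "i < l" for i
    using that l by (intro less.hyps) auto
  have "?d 0 * (\<Phi> k (M + q ^ j) * \<Phi> k 0)
      = \<Phi> k M * \<Phi> k 0 - (\<Sum>i<l. ?d (Suc i) * (\<Phi> k (M + q ^ (Suc i + j)) * \<Phi> k 0))"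
    by (subst rel[OF M]) (simp add: algebra_simps sum_distrib_left sum_distrib_right)
  also have "\<dots> = \<Phi> k M * \<Phi> k 0 - (\<Sum>i<l. ?d (Suc i) * (\<Phi> k M * \<Phi> k (q ^ (Suc i + j))))"
    by (intro arg_cong2[where f = "(-)"] sum.cong refl arg_cong2[where f = "(*)"] IH) simp
  also have "\<dots> = \<Phi> k M * (\<Phi> k 0 - (\<Sum>i<l. ?d (Suc i) * \<Phi> k (q ^ (Suc i + j))))"
    by (simp add: algebra_simps sum_distrib_left)
  \<comment> \<open>This is the relation for \<open>M = 0\<close>; the nonzero diagonal entry
    \<open>c 0 ^ (q ^ j)\<close> then cancels.\<close>
  also have "\<Phi> k 0 - (\<Sum>i<l. ?d (Suc i) * \<Phi> k (q ^ (Suc i + j))) = ?d 0 * \<Phi> k (q ^ j)"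
    using rel[of 0] q by simp
  finally show ?case
    using c0 by (simp add: mult.left_commute)
qed

section \<open>Product formula and the value at 0\<close>

text \<open>The extra factor \<open>\<Phi> k 0\<close> on the left avoids the exponent
  \<open>card I - 1\<close> and lets the induction start at the empty set. Before each new power is
  added, the digit sum of the partial sum is at most q - 2.\<close>

lemma \<Phi>_sum_powers:
  assumes c0: "c 0 \<noteq> 0" and "finite I" and "card I < q" and "\<And>i. i \<in> I \<Longrightarrow> \<kappa> i < k"
  shows "\<Phi> k 0 * (\<Prod>i\<in>I. \<Phi> k (q ^ \<kappa> i)) = \<Phi> k 0 ^ card I * \<Phi> k (\<Sum>i\<in>I. q ^ \<kappa> i)"
  using assms(2-4)
proof (induction I rule: finite_induct)
  case (insert x I)
  let ?M = "\<Sum>i\<in>I. q ^ \<kappa> i"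
  have "digit_sum q ?M + 2 \<le> q"
    using digit_sum_sum_powers_le[OF q \<open>finite I\<close>, of \<kappa>] insert.prems insert.hyps by simp
  then have step: "\<Phi> k (?M + q ^ \<kappa> x) * \<Phi> k 0 = \<Phi> k ?M * \<Phi> k (q ^ \<kappa> x)"
    using \<Phi>_add_power[OF c0] insert.prems by simp
  have IH: "\<Phi> k 0 * (\<Prod>i\<in>I. \<Phi> k (q ^ \<kappa> i)) = \<Phi> k 0 ^ card I * \<Phi> k ?M"
    using insert by simp
  have "\<Phi> k 0 * (\<Prod>i\<in>insert x I. \<Phi> k (q ^ \<kappa> i))
      = \<Phi> k (q ^ \<kappa> x) * (\<Phi> k 0 * (\<Prod>i\<in>I. \<Phi> k (q ^ \<kappa> i)))"
    using insert.hyps by (simp add: mult_ac)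
  also have "\<dots> = \<Phi> k 0 ^ card I * (\<Phi> k (?M + q ^ \<kappa> x) * \<Phi> k 0)"
    unfolding IH step by (simp add: mult_ac)
  finally show ?case
    using insert.hyps by (simp add: mult_ac add.commute)
qed simp

text \<open>For \<open>Suc k\<close>, the relation with \<open>j = k\<close> has one term: it shifts
  by \<open>q ^ k\<close> at the cost of a factor \<open>c 0 ^ (q ^ k)\<close>. After
  \<open>q - 1\<close> shifts from 0, the coefficient of 1/g at \<open>q ^ k - 1\<close> remains,
  which is \<open>\<Phi> k 0\<close>.\<close>

lemma \<Phi>_0: "\<Phi> k 0 = c 0 ^ (q ^ k - 1)"
proof (induction k)
  case 0
  show ?case
    by (simp add: \<Phi>_def)
next
  case (Suc k)
  have Q: "q ^ k > 0" "q ^ k \<le> q ^ Suc k"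
    using q by auto
  have shift: "\<Phi> (Suc k) 0 = c 0 ^ (r * q ^ k) * \<Phi> (Suc k) (r * q ^ k)" if "r < q" for r
    using that
  proof (induction r)
    case (Suc r)
    have "digit_sum q (r * q ^ k) \<le> r"
      using digit_sum_sum_powers_le[OF q, of "{..<r}" "\<lambda>_. k"] by simp
    then have "\<Phi> (Suc k) (r * q ^ k) = c 0 ^ (q ^ k) * \<Phi> (Suc k) (r * q ^ k + q ^ k)"
      using \<Phi>_linear_relation[of "r * q ^ k" k "Suc k"] Suc.prems by simp
    then show ?case
      using Suc by (simp add: power_add mult_ac add.commute)
  qed simp
  have split: "q ^ Suc k = (q - 1) * q ^ k + q ^ k"
    using q by (cases q) auto
  have "\<Phi> (Suc k) ((q - 1) * q ^ k) = fps_nth (inverse g) (q ^ Suc k - 1 - (q - 1) * q ^ k)"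
    using Q split by (intro \<Phi>_eq) linarith
  also have "q ^ Suc k - 1 - (q - 1) * q ^ k = q ^ k - 1"
    using split Q by linarith
  also have "fps_nth (inverse g) (q ^ k - 1) = c 0 ^ (q ^ k - 1)"
    using Suc Q by (simp add: \<Phi>_eq)
  finally have "\<Phi> (Suc k) 0 = c 0 ^ ((q - 1) * q ^ k + (q ^ k - 1))"
    using shift[of "q - 1"] q by (simp only: power_add)
  also have "(q - 1) * q ^ k + (q ^ k - 1) = q ^ Suc k - 1"
    using split Q by linarith
  finally show ?case .
qed

section \<open>Coefficients of a\<close>

text \<open>The exponents \<open>q ^ i\<close> with \<open>i > 0\<close> vanish in the field, as its
  characteristic divides \<open>q\<close>.\<close>

lemma deriv_q_power_series: "fps_deriv (q_power_series q c) = fps_const (c 0)"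
proof (rule fps_ext)
  fix n
  have "e > 0"
    using q q_eq by (cases e) auto
  then have q0: "of_nat q = (0 :: 'a)"
    using q_eq by (simp add: of_nat_eq_0_iff_char_dvd dvd_power)
  consider i where "Suc n = q ^ i" | "\<And>i. Suc n \<noteq> q ^ i"
    by blast
  then show "fps_nth (fps_deriv (q_power_series q c)) n = fps_nth (fps_const (c 0)) n"
  proof cases
    case 1
    have "fps_nth (fps_deriv (q_power_series q c)) n = of_nat (Suc n) * c i"
      using 1 q by (simp add: fps_nth_q_power_series_power del: of_nat_Suc)
    also have "of_nat (Suc n) = (of_nat q ^ i :: 'a)"
      unfolding 1 by simp
    finally show ?thesis
      using 1 q q0 by (cases i) auto
  next
    case 2
    then have "n \<noteq> 0"
      by (metis power_0 One_nat_def)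
    then show ?thesis
      using 2 fps_nth_q_power_series_other[of "Suc n" q c] by simp
  qed
qed

lemma nth_logarithmic_derivative:
  assumes "m < q ^ k"
  shows "fps_nth (fps_X * fps_deriv (q_power_series q c) / (1 - q_power_series q c)) (q ^ k - m)
    = c 0 * \<Phi> k m"
proof -
  have "fps_X * fps_deriv (q_power_series q c) / (1 - q_power_series q c)
      = fps_const (c 0) * (fps_X * inverse g)"
    unfolding deriv_q_power_series g_def[symmetric]
    by (subst fps_divide_unit) (simp_all add: mult_ac)
  moreover have "q ^ k - m - 1 = q ^ k - 1 - m" "q ^ k - m \<noteq> 0"
    using assms by auto
  ultimately show ?thesis
    using assms by (simp add: \<Phi>_eq)
qed

end

theorem theorem4:
  fixes q s k :: nat and K :: "'a::field set" and c :: "nat \<Rightarrow> 'a"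
    and f a :: "'a fps" and \<kappa> :: "nat \<Rightarrow> nat"
  assumes "primepow q"
    and "is_subfield K" and "card K = q"
    and "f = q_power_series q c"
    and "a = fps_X * fps_deriv f / (1 - f)"
    and "1 \<le> s" and "s < q" and "1 \<le> k"
    and "\<And>i. i \<in> {1..s} \<Longrightarrow> \<kappa> i < k"
  shows "(\<Prod>i=1..s. fps_nth a (q ^ k - q ^ \<kappa> i))
       = c 0 ^ ((s - 1) * q ^ k) * fps_nth a (q ^ k - (\<Sum>i=1..s. q ^ \<kappa> i))"
proof -
  have q: "q > 1"
    using assms(1) by (rule primepow_gt_Suc_0[unfolded One_nat_def[symmetric]])
  obtain e where "prime CHAR('a)" "q = CHAR('a) ^ e"
    using primepow_card_subfield[of K] assms(1-3) by metis
  then interpret q_power_reciprocal q e c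
    using q by unfold_locales
  let ?M = "\<Sum>i=1..s. q ^ \<kappa> i"
  have a: "fps_nth a (q ^ k - m) = c 0 * \<Phi> k m" if "m < q ^ k" for m
    using nth_logarithmic_derivative[OF that] assms(4,5) by simp
  \<comment> \<open>Since \<open>s < q\<close>, the exponent sum stays below \<open>q ^ k\<close>,
    so the index on the right is a genuine difference and \<open>a\<close> applies to it.\<close>
  have "?M \<le> (\<Sum>i=1..s. q ^ (k - 1))"
    using assms(9) q by (intro sum_mono power_increasing) fastforce+
  also have "\<dots> < q * q ^ (k - 1)"
    using assms(7) q by simp
  also have "\<dots> = q ^ k"
    using assms(8) by (cases k) auto
  finally have M: "?M < q ^ k" .
  show ?thesis
  \<comment> \<open>If \<open>c 0 = 0\<close>, both sides vanish, the product because
    \<open>s \<ge> 1\<close> gives it a factor. Otherwise \<open>\<Phi> k 0\<close> is nonzero and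
    can be cancelled.\<close>
  proof (cases "c 0 = 0")
    case True
    then show ?thesis
      using a[OF M] a[of "q ^ \<kappa> 1"] assms(6,9) q by (auto intro!: prod_zero)
  next
    case False
    have s: "Suc (s - 1) = s"
      using assms(6) by simp
    have \<Phi>0: "\<Phi> k 0 \<noteq> 0" "c 0 * \<Phi> k 0 = c 0 ^ (q ^ k)"
      using False q by (simp_all add: \<Phi>_0 flip: power_Suc)
    have "\<Phi> k 0 * (\<Prod>i=1..s. \<Phi> k (q ^ \<kappa> i)) = \<Phi> k 0 ^ s * \<Phi> k ?M"
      using \<Phi>_sum_powers[OF False, of "{1..s}" \<kappa> k] assms(7,9) by simp
    also have "\<dots> = \<Phi> k 0 * (\<Phi> k 0 ^ (s - 1) * \<Phi> k ?M)"
      by (subst s[symmetric]) (simp add: mult_ac)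
    finally have prod: "(\<Prod>i=1..s. \<Phi> k (q ^ \<kappa> i)) = \<Phi> k 0 ^ (s - 1) * \<Phi> k ?M"
      using \<Phi>0 by simp
    have "(\<Prod>i=1..s. fps_nth a (q ^ k - q ^ \<kappa> i)) = (\<Prod>i=1..s. c 0 * \<Phi> k (q ^ \<kappa> i))"
      using assms(9) q by (intro prod.cong refl a) auto
    also have "\<dots> = c 0 ^ s * (\<Phi> k 0 ^ (s - 1) * \<Phi> k ?M)"
      using prod by (simp add: prod.distrib)
    \<comment> \<open>Of the \<open>s\<close> factors \<open>c 0\<close>, all but one pair with
      \<open>\<Phi> k 0\<close> to give \<open>c 0 ^ (q ^ k)\<close>; the last turns
      \<open>\<Phi> k ?M\<close> into a coefficient of \<open>a\<close>.\<close>
    also have "\<dots> = (c 0 * \<Phi> k 0) ^ (s - 1) * (c 0 * \<Phi> k ?M)"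
      by (subst s[symmetric]) (simp add: power_mult_distrib mult_ac)
    also have "\<dots> = c 0 ^ ((s - 1) * q ^ k) * fps_nth a (q ^ k - ?M)"
      using \<Phi>0 a[OF M] by (simp add: mult.commute flip: power_mult)
    finally show ?thesis .
  qed
qed

end
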